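(* Let $z\in\mathbb{C}$ with $\Re(z)>0$ and $z\neq 1$, and let $\sqrt{z}$ denote the principal square root. Then $$\int_0^\infty\frac{\sqrt{t}}{(t+1)(t+z)}\,dt=\frac{\pi}{z-1}\left(\sqrt{z}-1\right),$$ and for every integer $j\ge 1$, $$\int_0^\infty\frac{\sqrt{t}}{(t+1)(t+z)^{j+1}}\,dt=\frac{\pi}{(z-1)^{j+1}}\left(\sqrt{z}-1-\frac{z-1}{2\sqrt{z}}\sum_{k=0}^{j-1}C_k\left(\frac{z-1}{4z}\right)^k\right).$$ Moreover, if in addition $\Re(z)\ge \frac12$, then for every integer $j\ge 1$ this integral is also equal to $$\frac{\pi}{2\sqrt{z}\,(z-1)^{j}}\sum_{k=j}^{\infty}C_k\left(\frac{z-1}{4z}\right)^k.$$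
   Context: $C_k=\frac{1}{k+1}\binom{2k}{k}$, $k\ge 0$, are the Catalan numbers. *)

theory Defs
  imports "HOL-Analysis.Analysis"
begin

definition catalan :: "nat \<Rightarrow> real" where
  "catalan k = 1 / real (k + 1) * real ((2 * k) choose k)"

end

theory Submission
  imports Defs
begin

text \<open>
Write \<open>I j\<close> for the integral with exponent \<open>j + 1\<close> and \<open>J m\<close> for the integral of \<open>sqrt t / (t + z) ^ m\<close>.
The substitution \<open>t = s\<^sup>2\<close> gives antiderivatives of the integrands of \<open>I 0\<close> and \<open>J 2\<close> in terms of the complex arctangent
of \<open>sqrt t / csqrt z\<close>. Integrating the derivative of \<open>t * sqrt t / (t + z) ^ m\<close> relates \<open>J (m + 1)\<close> to \<open>J m\<close>; this
is the recursion of the Catalan numbers. Partial fractions give \<open>(z - 1) * I (j + 1) = I j - J (j + 2)\<close>, whence the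
finite formula. If \<open>Re z \<ge> 1 / 2\<close>, then \<open>\<bar>z - 1\<bar> \<le> \<bar>z\<bar> < \<bar>t + z\<bar>\<close> for \<open>t > 0\<close>, so \<open>(z - 1) ^ j * I j\<close> tends to \<open>0\<close> by dominated
convergence and the finite formula itself evaluates the Catalan generating function at \<open>(z - 1) / (4 * z)\<close>, up to the
boundary of its disc of convergence.
\<close>

section \<open>The complex arctangent on the right half-plane\<close>

text \<open>The two derivatives cancel on the open right half-plane; this set is convex, so the sum
  is constant there, and its value is read off at 1. The identity trades the behaviour of
  \<open>Arctan\<close> at infinity for its continuity at 0.\<close>

lemma Arctan_add_Arctan_inverse:
  assumes "Re w > 0"
  shows "Arctan w + Arctan (inverse w) = of_real (pi / 2)"
proof -
  let ?S = "{x::complex. Re x > 0}"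
  have deriv: "((\<lambda>x. Arctan x + Arctan (inverse x)) has_field_derivative 0) (at x within ?S)"
    if "x \<in> ?S" for x
  proof -
    have x: "x \<noteq> 0" "Re x > 0" "Re (inverse x) > 0" using that
      by (auto simp: Re_complex_div_gt_0 inverse_eq_divide)
    have "x\<^sup>2 \<noteq> -1"
    proof
      assume "x\<^sup>2 = -1"
      then have "x = \<i> \<or> x = -\<i>" by (metis power2_eq_iff i_squared power2_eq_square)
      with x show False by auto
    qed
    then have 1: "1 + x\<^sup>2 \<noteq> 0" by (simp add: add_eq_0_iff)
    have "inverse (1 + x\<^sup>2) + - (inverse x * 1 * inverse x) * inverse (1 + (inverse x)\<^sup>2) = 0"
      using x 1 by (simp add: field_simps power2_eq_square)
    moreover have "((\<lambda>x. Arctan x + Arctan (inverse x)) has_field_derivative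
       (inverse (1 + x\<^sup>2) + - (inverse x * 1 * inverse x) * inverse (1 + (inverse x)\<^sup>2))) (at x within ?S)"
      using x by (auto intro!: derivative_eq_intros)
    ultimately show ?thesis by simp
  qed
  have "\<exists>c. \<forall>x\<in>?S. Arctan x + Arctan (inverse x) = c"
    using has_field_derivative_zero_constant[OF convex_halfspace_Re_gt[of 0] deriv] by blast
  then obtain c where c: "\<And>x. Re x > 0 \<Longrightarrow> Arctan x + Arctan (inverse x) = c" by auto
  have "Arctan 1 = of_real (pi / 4)"
    using Arctan_of_real[of 1] by (simp add: arctan_one)
  with c[of 1] have "c = of_real (pi / 2)" by simp
  with c[OF assms] show ?thesis by simp
qed

lemma Re_csqrt_pos:
  assumes "Re z > 0"
  shows "Re (csqrt z) > 0"
  using assms by (simp add: add_nonneg_pos)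

lemma Re_of_real_div_pos:
  assumes "Re c > 0" "s > 0"
  shows "Re (of_real s / c) > 0"
  unfolding Re_complex_div_gt_0 using assms by simp

text \<open>The argument is unbounded, but its inverse \<open>c / sqrt t\<close> tends to 0, so the
  reflection identity reduces the limit to continuity of \<open>Arctan\<close> at 0.\<close>

lemma tendsto_Arctan_sqrt_at_top:
  assumes "Re c > 0"
  shows "((\<lambda>t. Arctan (of_real (sqrt t) / c)) \<longlongrightarrow> of_real (pi / 2)) at_top"
proof -
  have "((\<lambda>t. c * of_real (inverse (sqrt t))) \<longlongrightarrow> c * of_real 0) at_top"
    by (intro tendsto_intros tendsto_inverse_0_at_top sqrt_at_top)
  then have lim: "((\<lambda>t. c * of_real (inverse (sqrt t))) \<longlongrightarrow> 0) at_top" by simp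
  have "isCont Arctan 0" by (rule continuous_at_Arctan) auto
  from isCont_tendsto_compose[OF this lim]
  have "((\<lambda>t. of_real (pi / 2) - Arctan (c * of_real (inverse (sqrt t)))) \<longlongrightarrow> of_real (pi / 2) - Arctan 0) at_top"
    by (intro tendsto_intros)
  moreover have "\<forall>\<^sub>F t in at_top. of_real (pi / 2) - Arctan (c * of_real (inverse (sqrt t)))
       = Arctan (of_real (sqrt t) / c)"
    using eventually_gt_at_top[of "0::real"]
  proof eventually_elim
    case (elim t)
    have "Re (of_real (sqrt t) / c) > 0"
      using assms elim by (intro Re_of_real_div_pos) simp_all
    moreover have "inverse (of_real (sqrt t) / c) = c * of_real (inverse (sqrt t))"
      by (simp add: divide_inverse)
    ultimately show ?case
      using Arctan_add_Arctan_inverse[of "of_real (sqrt t) / c"] by (metis add_diff_cancel_right')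
  qed
  ultimately show ?thesis by (simp add: filterlim_cong tendsto_cong)
qed

lemma has_vector_derivative_of_real_sqrt:
  assumes "t > 0"
  shows "((\<lambda>t. complex_of_real (sqrt t)) has_vector_derivative of_real (inverse (sqrt t) / 2)) (at t)"
  by (rule has_vector_derivative_of_real[OF DERIV_real_sqrt[OF assms]])

text \<open>The argument has positive real part and so avoids the branch cuts, which lie on the
  imaginary axis. Keeping \<open>c\<close> free lets the lemma serve both denominators:
  \<open>c = csqrt z\<close> yields \<open>t + z\<close>, and \<open>c = 1\<close> yields
  \<open>t + 1\<close>.\<close>

lemma has_vector_derivative_Arctan_sqrt:
  assumes "Re c > 0" "t > 0"
  shows "((\<lambda>t. Arctan (of_real (sqrt t) / c)) has_vector_derivative
           c / (2 * of_real (sqrt t) * (of_real t + c\<^sup>2))) (at t)"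
proof -
  have c: "c \<noteq> 0" using assms by auto
  have "((\<lambda>t. of_real (sqrt t) / c) has_vector_derivative of_real (inverse (sqrt t) / 2) / c) (at t)"
    using assms by (intro has_vector_derivative_divide has_vector_derivative_of_real_sqrt)
  moreover have "Re (of_real (sqrt t) / c) > 0"
    using assms by (intro Re_of_real_div_pos) simp_all
  then have "(Arctan has_field_derivative inverse (1 + (of_real (sqrt t) / c)\<^sup>2)) (at (of_real (sqrt t) / c))"
    by (intro has_field_derivative_Arctan) (metis less_irrefl)
  ultimately have "((Arctan \<circ> (\<lambda>t. of_real (sqrt t) / c)) has_vector_derivative
      of_real (inverse (sqrt t) / 2) / c * inverse (1 + (of_real (sqrt t) / c)\<^sup>2)) (at t)"
    by (rule field_vector_diff_chain_at)
  then have deriv: "((\<lambda>t. Arctan (of_real (sqrt t) / c)) has_vector_derivative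
      of_real (inverse (sqrt t) / 2) / c * inverse (1 + (of_real (sqrt t) / c)\<^sup>2)) (at t)"
    by (simp only: o_def)
  have sq: "(of_real (sqrt t))\<^sup>2 = (of_real t :: complex)"
    using assms by (simp flip: of_real_power)
  have "1 + (of_real (sqrt t) / c)\<^sup>2 = (of_real t + c\<^sup>2) / c\<^sup>2"
    unfolding power_divide sq using c by (simp add: add_divide_distrib)
  then have "inverse (1 + (of_real (sqrt t) / c)\<^sup>2) = c\<^sup>2 / (of_real t + c\<^sup>2)"
    by (simp only: inverse_divide)
  moreover have "of_real (inverse (sqrt t) / 2) / c * (c\<^sup>2 / d) = c / (2 * of_real (sqrt t) * d)" for d
    using c by (simp add: power2_eq_square field_simps)
  ultimately show ?thesis using deriv by (simp only:)
qed

section \<open>Bounds for the denominators and integrability of the kernels\<close>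

text \<open>Already the real part \<open>t + Re z\<close> is this large. The bound reduces every
  growth and integrability question to the real denominator \<open>t + 1\<close>.\<close>

lemma norm_of_real_add_ge:
  fixes z :: complex
  assumes "Re z > 0" "t \<ge> 0"
  shows "norm (of_real t + z) \<ge> min 1 (Re z) * (t + 1)"
proof -
  have "min 1 (Re z) * (t + 1) = min 1 (Re z) * t + min 1 (Re z)" by (simp add: algebra_simps)
  also have "\<dots> \<le> 1 * t + Re z"
    using assms by (intro add_mono mult_right_mono) auto
  also have "\<dots> = Re (of_real t + z)" by simp
  also have "\<dots> \<le> norm (of_real t + z)" by (rule complex_Re_le_cmod)
  finally show ?thesis .
qed

lemma of_real_add_nonzero:
  fixes z :: complex
  assumes "Re z > 0" "t \<ge> 0"
  shows "of_real t + z \<noteq> 0"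
  using assms by (auto simp: complex_eq_iff)

lemma tendsto_sqrt_div_at_top: "((\<lambda>t::real. sqrt t / (t + 1)) \<longlongrightarrow> 0) at_top"
proof (rule tendsto_sandwich[where f = "\<lambda>_. 0" and h = "\<lambda>t. inverse (sqrt t)"])
  show "((\<lambda>t::real. inverse (sqrt t)) \<longlongrightarrow> 0) at_top"
    by (rule tendsto_inverse_0_at_top[OF sqrt_at_top])
  show "\<forall>\<^sub>F t::real in at_top. sqrt t / (t + 1) \<le> inverse (sqrt t)"
    using eventually_gt_at_top[of "0::real"]
    by eventually_elim (simp add: field_simps)
  show "\<forall>\<^sub>F t::real in at_top. 0 \<le> sqrt t / (t + 1)"
    using eventually_gt_at_top[of "0::real"] by eventually_elim simp
qed (rule tendsto_const)

text \<open>Since \<open>n > k\<close>, the denominator absorbs \<open>t ^ k\<close> and still has a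
  factor \<open>t + 1\<close> to beat the square root. This makes the boundary terms of the
  antiderivatives vanish at infinity.\<close>

lemma tendsto_power_sqrt_div_at_top:
  fixes z :: complex
  assumes "Re z > 0" "n > k"
  shows "((\<lambda>t. of_real (t ^ k * sqrt t) / (of_real t + z) ^ n) \<longlongrightarrow> 0) at_top"
proof (rule Lim_null_comparison)
  define m where "m = min 1 (Re z)"
  have m: "m > 0" using assms by (simp add: m_def)
  show "((\<lambda>t. inverse (m ^ n) * (sqrt t / (t + 1))) \<longlongrightarrow> 0) at_top"
    by (intro tendsto_mult_right_zero tendsto_sqrt_div_at_top)
  show "\<forall>\<^sub>F t in at_top. norm (of_real (t ^ k * sqrt t) / (of_real t + z) ^ n)
           \<le> inverse (m ^ n) * (sqrt t / (t + 1))"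
    using eventually_gt_at_top[of "0::real"]
  proof eventually_elim
    case (elim t)
    have "(m * (t + 1)) ^ n \<le> norm (of_real t + z) ^ n"
      using norm_of_real_add_ge[of z t] assms elim m by (intro power_mono) (auto simp: m_def)
    moreover have "t ^ k * (t + 1) \<le> (t + 1) ^ n"
    proof -
      have "t ^ k * (t + 1) \<le> (t + 1) ^ k * (t + 1)"
        using elim by (intro mult_right_mono power_mono) auto
      also have "\<dots> = (t + 1) ^ Suc k" by simp
      also have "\<dots> \<le> (t + 1) ^ n" using assms elim by (intro power_increasing) auto
      finally show ?thesis .
    qed
    then have "m ^ n * (t ^ k * (t + 1)) \<le> (m * (t + 1)) ^ n"
      using m by (simp add: power_mult_distrib)
    ultimately have "m ^ n * (t ^ k * (t + 1)) \<le> norm (of_real t + z) ^ n"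
      by linarith
    then have "t ^ k * sqrt t / norm (of_real t + z) ^ n \<le> t ^ k * sqrt t / (m ^ n * (t ^ k * (t + 1)))"
      using elim m by (intro frac_le) auto
    then show ?case
      using elim m by (simp add: norm_divide norm_mult norm_power norm_inverse divide_inverse mult_ac)
  qed
qed

text \<open>The integrand is nonnegative and its antiderivative
  \<open>arctan (sqrt t) - sqrt t / (t + 1)\<close> has finite limits at both ends, which already
  gives integrability. This is the dominating function for all kernels below.\<close>

lemma set_integrable_sqrt_div_square:
  "set_integrable lborel {0<..} (\<lambda>t. sqrt t / (t + 1)\<^sup>2)"
proof -
  have "set_integrable lborel (einterval (ereal 0) \<infinity>) (\<lambda>t. sqrt t / (t + 1)\<^sup>2)"
  proof (rule interval_integral_FTC_nonneg(1))
    show "DERIV (\<lambda>t. arctan (sqrt t) - sqrt t / (t + 1)) x :> sqrt x / (x + 1)\<^sup>2"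
      if "ereal 0 < ereal x" for x
    proof -
      define s where "s = sqrt x"
      have s: "s > 0" "x = s\<^sup>2" using that by (auto simp: s_def)
      have "DERIV (\<lambda>t. arctan (sqrt t) - sqrt t / (t + 1)) x :>
          inverse s / 2 * inverse (1 + s\<^sup>2) - (inverse s / 2 * (x + 1) - s * 1) / ((x + 1) * (x + 1))"
        using that by (auto intro!: derivative_eq_intros simp: s_def)
      moreover have "inverse s / 2 * inverse (1 + s\<^sup>2) - (inverse s / 2 * (x + 1) - s * 1) / ((x + 1) * (x + 1))
          = s / (x + 1)\<^sup>2"
      proof -
        have "inverse s / 2 * inverse (1 + s\<^sup>2) = (inverse s / 2 * (x + 1)) / ((x + 1) * (x + 1))"
          using s by (simp add: divide_simps add_ac)
        then show ?thesis by (simp add: diff_divide_distrib power2_eq_square)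
      qed
      ultimately show ?thesis by (simp add: s_def)
    qed
    show "isCont (\<lambda>t. sqrt t / (t + 1)\<^sup>2) x" if "ereal 0 < ereal x" for x
      using that by (auto intro!: continuous_intros)
    have "((\<lambda>t. arctan (sqrt t) - sqrt t / (t + 1)) \<longlongrightarrow> arctan (sqrt 0) - sqrt 0 / (0 + 1)) (at_right 0)"
      by (intro tendsto_intros) auto
    then show "(((\<lambda>t. arctan (sqrt t) - sqrt t / (t + 1)) \<circ> real_of_ereal) \<longlongrightarrow> 0) (at_right (ereal 0))"
      by (simp add: ereal_tendsto_simps)
    have "((\<lambda>t. arctan (sqrt t) - sqrt t / (t + 1)) \<longlongrightarrow> pi/2 - 0) at_top"
    proof (intro tendsto_diff)
      show "((\<lambda>t. arctan (sqrt t)) \<longlongrightarrow> pi/2) at_top"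
        by (rule filterlim_compose[OF tendsto_arctan_at_top sqrt_at_top])
      show "((\<lambda>t. sqrt t / (t + 1)) \<longlongrightarrow> 0) at_top" by (rule tendsto_sqrt_div_at_top)
    qed
    then show "(((\<lambda>t. arctan (sqrt t) - sqrt t / (t + 1)) \<circ> real_of_ereal) \<longlongrightarrow> pi/2) (at_left \<infinity>)"
      by (simp add: ereal_tendsto_simps)
  qed auto
  then show ?thesis by simp
qed

text \<open>The two free exponents cover all integrands at once: with \<open>w = 1\<close>, the
  choice \<open>a = 1\<close> gives those with the factor \<open>t + 1\<close>, and
  \<open>a = 0\<close> the pure powers of \<open>t + z\<close>. The condition
  \<open>a + b \<ge> 2\<close> is what allows comparison with
  \<open>sqrt t / (t + 1)\<^sup>2\<close>.\<close>

lemma set_integrable_sqrt_kernel: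
  fixes z w :: complex
  assumes "Re z > 0" "Re w > 0" "a + b \<ge> 2"
  shows "set_integrable lborel {0<..} (\<lambda>t. of_real (sqrt t) / ((of_real t + w) ^ a * (of_real t + z) ^ b))"
proof -
  \<comment> \<open>The product of the constants in the lower bounds for the \<open>a + b\<close>
    factors of the denominator.\<close>
  define K where "K = min 1 (Re w) ^ a * min 1 (Re z) ^ b"
  have K: "K > 0" using assms by (simp add: K_def)
  have "set_integrable lborel {0<..} (\<lambda>t. inverse K * (sqrt t / (t + 1)\<^sup>2))"
    using set_integrable_sqrt_div_square by (intro set_integrable_mult_right)
  then show ?thesis
  proof (rule set_integrable_bound)
    show "set_borel_measurable lborel {0<..} (\<lambda>t. of_real (sqrt t) / ((of_real t + w) ^ a * (of_real t + z) ^ b))"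
      unfolding set_borel_measurable_def by measurable
    show "AE t in lborel. t \<in> {0<..} \<longrightarrow>
      norm (of_real (sqrt t) / ((of_real t + w) ^ a * (of_real t + z) ^ b) :: complex)
       \<le> norm (inverse K * (sqrt t / (t + 1)\<^sup>2))"
    proof (intro AE_I2 impI)
      fix t :: real assume "t \<in> {0<..}"
      then have t: "t > 0" by simp
      have "K * (t + 1)\<^sup>2 \<le> K * (t + 1) ^ (a + b)"
        using t assms K by (intro mult_left_mono power_increasing) auto
      also have "\<dots> = (min 1 (Re w) * (t + 1)) ^ a * (min 1 (Re z) * (t + 1)) ^ b"
        by (simp add: K_def power_mult_distrib power_add mult_ac)
      also have "\<dots> \<le> norm (of_real t + w) ^ a * norm (of_real t + z) ^ b"
        using t assms
        by (intro mult_mono power_mono norm_of_real_add_ge zero_le_power mult_nonneg_nonneg) auto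
      finally have "sqrt t / (norm (of_real t + w) ^ a * norm (of_real t + z) ^ b) \<le> sqrt t / (K * (t + 1)\<^sup>2)"
        using K t by (intro frac_le mult_pos_pos) auto
      then show "norm (of_real (sqrt t) / ((of_real t + w) ^ a * (of_real t + z) ^ b) :: complex)
       \<le> norm (inverse K * (sqrt t / (t + 1)\<^sup>2))"
        using K t by (simp add: norm_divide norm_mult norm_power norm_inverse divide_inverse mult_ac)
    qed
  qed
qed

section \<open>The fundamental theorem on the half-line and the two base integrals\<close>

text \<open>The square root is not differentiable at 0, so the left endpoint enters only through a
  one-sided limit. The limits are taken along real filters, which spares the applications any
  extended reals.\<close>

lemma interval_integral_FTC_0_infinity:
  fixes f F :: "real \<Rightarrow> 'a::euclidean_space"
  assumes "\<And>t. t > 0 \<Longrightarrow> (F has_vector_derivative f t) (at t)"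
    and "\<And>t. t > 0 \<Longrightarrow> isCont f t"
    and "set_integrable lborel {0<..} f"
    and "(F \<longlongrightarrow> A) (at_right 0)" and "(F \<longlongrightarrow> B) at_top"
  shows "(LBINT t=0..\<infinity>. f t) = B - A"
proof -
  have "(LBINT t=ereal 0..\<infinity>. f t) = B - A"
    by (rule interval_integral_FTC_integrable[where F = F])
      (use assms in \<open>auto simp: ereal_tendsto_simps\<close>)
  then show ?thesis by (simp add: zero_ereal_def)
qed

lemma interval_lebesgue_integrable_0_infinity:
  "interval_lebesgue_integrable lborel 0 \<infinity> f \<longleftrightarrow> set_integrable lborel {0<..} f"
  by (simp add: interval_lebesgue_integrable_def zero_ereal_def)

lemma isCont_sqrt_kernel:
  fixes z w :: complex
  assumes "Re z > 0" "Re w > 0" "t > 0"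
  shows "isCont (\<lambda>t. of_real (sqrt t) / ((of_real t + w) ^ a * (of_real t + z) ^ b)) t"
  using of_real_add_nonzero[of z t] of_real_add_nonzero[of w t] assms
  by (intro continuous_intros) auto

lemma tendsto_Arctan_sqrt_at_right:
  assumes "Re c > 0"
  shows "((\<lambda>t. Arctan (of_real (sqrt t) / c)) \<longlongrightarrow> 0) (at_right 0)"
proof -
  have c: "c \<noteq> 0" using assms by auto
  have "((\<lambda>t. complex_of_real (sqrt t) / c) \<longlongrightarrow> of_real (sqrt 0) / c) (at_right 0)"
    using c by (intro tendsto_intros) auto
  then have lim: "((\<lambda>t. complex_of_real (sqrt t) / c) \<longlongrightarrow> 0) (at_right 0)" by simp
  have "isCont Arctan 0" by (rule continuous_at_Arctan) auto
  from isCont_tendsto_compose[OF this lim] show ?thesis by simp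
qed

text \<open>With \<open>t = s\<^sup>2\<close> the integrand becomes
  \<open>2 * s\<^sup>2 / ((s\<^sup>2 + 1) * (s\<^sup>2 + z))\<close>, and partial fractions turn
  this into \<open>2 / (z - 1)\<close> times
  \<open>z / (s\<^sup>2 + z) - 1 / (s\<^sup>2 + 1)\<close>. Each piece integrates to an
  arctangent.\<close>

lemma LBINT_sqrt_div_mult:
  assumes "Re z > 0" "z \<noteq> 1"
  shows "(LBINT t=0..\<infinity>. complex_of_real (sqrt t) / ((complex_of_real t + 1) * (complex_of_real t + z)))
       = complex_of_real pi / (z - 1) * (csqrt z - 1)"
proof -
  define c where "c = csqrt z"
  have c: "Re c > 0" "c\<^sup>2 = z" "c \<noteq> 0" unfolding c_def
    using assms Re_csqrt_pos[of z] by auto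
  \<comment> \<open>The redundant \<open>1 *\<close> and \<open>/ 1\<close> give the second summand
    the shape of the first, so the same derivative and limit rules apply to both.\<close>
  define F where "F = (\<lambda>t. (c * Arctan (of_real (sqrt t) / c) - 1 * Arctan (of_real (sqrt t) / 1)) * (2 / (z - 1)))"
  have "(LBINT t=0..\<infinity>. complex_of_real (sqrt t) / ((complex_of_real t + 1) * (complex_of_real t + z)))
     = (c * of_real (pi / 2) - 1 * of_real (pi / 2)) * (2 / (z - 1)) - (c * 0 - 1 * 0) * (2 / (z - 1))"
  proof (rule interval_integral_FTC_0_infinity[where F = F])
    fix t :: real assume t: "t > 0"
    define s where "s = complex_of_real (sqrt t)"
    have s: "s \<noteq> 0" "complex_of_real t = s * s"
      using t by (auto simp: s_def simp flip: of_real_mult)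
    have nz: "of_real t + z \<noteq> 0" "complex_of_real t + 1 \<noteq> 0"
      using t assms of_real_add_nonzero[of z t] of_real_add_nonzero[of 1 t] by auto
    have "(F has_vector_derivative
      (c * (c / (2 * s * (of_real t + c\<^sup>2))) - 1 * (1 / (2 * s * (of_real t + 1\<^sup>2)))) * (2 / (z - 1))) (at t)"
      unfolding F_def s_def using c(1) t
      by (intro has_vector_derivative_mult_left has_vector_derivative_mult_right
          has_vector_derivative_diff has_vector_derivative_Arctan_sqrt) simp_all
    moreover have "c * (c / (2 * s * (of_real t + c\<^sup>2))) = z / (2 * s * (of_real t + z))"
      using c(2) by (simp add: power2_eq_square)
    moreover have "(z / (2 * s * (of_real t + z)) - 1 * (1 / (2 * s * (of_real t + 1\<^sup>2)))) * (2 / (z - 1))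
       = s / ((of_real t + 1) * (of_real t + z))"
    proof -
      have "z / (2 * s * (of_real t + z)) - 1 * (1 / (2 * s * (of_real t + 1\<^sup>2)))
         = (z * (of_real t + 1) - (of_real t + z)) / (2 * s * ((of_real t + 1) * (of_real t + z)))"
        using s(1) nz by (simp add: divide_simps)
      also have "z * (of_real t + 1) - (of_real t + z) = (z - 1) * (s * s)"
        by (simp add: s(2) algebra_simps)
      finally have "z / (2 * s * (of_real t + z)) - 1 * (1 / (2 * s * (of_real t + 1\<^sup>2)))
         = (z - 1) * (s * s) / (2 * s * ((of_real t + 1) * (of_real t + z)))" .
      moreover have "(z - 1) * (s * s) / (2 * s * p) * (2 / (z - 1)) = s / p" for p
        using s(1) assms by simp
      ultimately show ?thesis by (simp only:)
    qed
    ultimately show "(F has_vector_derivative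
       complex_of_real (sqrt t) / ((complex_of_real t + 1) * (complex_of_real t + z))) (at t)"
      by (simp only: s_def)
  next
    fix t :: real assume t: "t > 0"
    show "isCont (\<lambda>t. complex_of_real (sqrt t) / ((complex_of_real t + 1) * (complex_of_real t + z))) t"
      using isCont_sqrt_kernel[of z 1 t 1 1] assms t by simp
  next
    show "set_integrable lborel {0<..} (\<lambda>t. complex_of_real (sqrt t) / ((complex_of_real t + 1) * (complex_of_real t + z)))"
      using set_integrable_sqrt_kernel[of z 1 1 1] assms by simp
    show "(F \<longlongrightarrow> (c * 0 - 1 * 0) * (2 / (z - 1))) (at_right 0)"
      unfolding F_def using c(1) by (intro tendsto_intros tendsto_Arctan_sqrt_at_right) simp_all
    show "(F \<longlongrightarrow> (c * of_real (pi / 2) - 1 * of_real (pi / 2)) * (2 / (z - 1))) at_top"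
      unfolding F_def using c(1) by (intro tendsto_intros tendsto_Arctan_sqrt_at_top) simp_all
  qed
  also have "\<dots> = complex_of_real pi / (z - 1) * (c - 1)"
    using assms by (simp add: field_simps)
  finally show ?thesis by (simp only: c_def)
qed

text \<open>After \<open>t = s\<^sup>2\<close>, integration by parts gives an arctangent and the
  term \<open>s / (s\<^sup>2 + z)\<close>, which vanishes at both ends. Only the limit
  \<open>pi / 2\<close> of the arctangent survives.\<close>

lemma LBINT_sqrt_div_square:
  assumes "Re z > 0"
  shows "(LBINT t=0..\<infinity>. complex_of_real (sqrt t) / (complex_of_real t + z)\<^sup>2)
       = complex_of_real pi / (2 * csqrt z)"
proof -
  define c where "c = csqrt z"
  have c: "Re c > 0" "c\<^sup>2 = z" "c \<noteq> 0" unfolding c_def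
    using assms Re_csqrt_pos[of z] by auto
  define F where "F = (\<lambda>t. Arctan (of_real (sqrt t) / c) / c - of_real (sqrt t) / (of_real t + z))"
  have "(LBINT t=0..\<infinity>. complex_of_real (sqrt t) / (complex_of_real t + z)\<^sup>2)
     = (of_real (pi / 2) / c - 0) - (0 / c - of_real (sqrt 0) / (of_real 0 + z))"
  proof (rule interval_integral_FTC_0_infinity[where F = F])
    fix t :: real assume t: "t > 0"
    define s where "s = complex_of_real (sqrt t)"
    have nz: "of_real t + z \<noteq> 0"
      using t assms of_real_add_nonzero[of z t] by auto
    have 1: "((\<lambda>t. complex_of_real (sqrt t)) has_vector_derivative inverse s / 2) (at t)"
      using has_vector_derivative_of_real_sqrt[OF t] by (simp add: s_def)
    have "((\<lambda>w. inverse (w + z)) has_field_derivative - (inverse (of_real t + z) * inverse (of_real t + z))) (at (of_real t))"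
      using nz by (auto intro!: derivative_eq_intros)
    then have 2: "((\<lambda>t. inverse (of_real t + z)) has_vector_derivative - (inverse (of_real t + z) * inverse (of_real t + z))) (at t)"
      by (rule has_vector_derivative_real_field)
    have "(F has_vector_derivative
      c / (2 * s * (of_real t + c\<^sup>2)) / c
       - (s * - (inverse (of_real t + z) * inverse (of_real t + z)) + inverse s / 2 * inverse (of_real t + z))) (at t)"
      unfolding F_def divide_inverse[of "of_real _" "of_real _ + z"] using c(1) t 1 2 unfolding s_def
      by (intro has_vector_derivative_diff has_vector_derivative_divide
          has_vector_derivative_mult has_vector_derivative_Arctan_sqrt)
    \<comment> \<open>The derivative of the arctangent term equals the product-rule term that
      differentiates the square root, so these two cancel.\<close>
    moreover have "c / (2 * s * (of_real t + c\<^sup>2)) / c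
       - (s * - (inverse (of_real t + z) * inverse (of_real t + z)) + inverse s / 2 * inverse (of_real t + z))
       = s / (of_real t + z)\<^sup>2"
    proof -
      have "c / (2 * s * d) / c = inverse s / 2 * inverse d" for d
        using c(3) by (simp add: field_simps)
      moreover have "x - (s * - (inverse d * inverse d) + x) = s / d\<^sup>2" for x d
        by (simp add: divide_inverse power2_eq_square)
      ultimately show ?thesis by (simp only: c(2))
    qed
    ultimately show "(F has_vector_derivative
       complex_of_real (sqrt t) / (complex_of_real t + z)\<^sup>2) (at t)"
      by (simp only: s_def)
  next
    fix t :: real assume t: "t > 0"
    show "isCont (\<lambda>t. complex_of_real (sqrt t) / (complex_of_real t + z)\<^sup>2) t"
      using isCont_sqrt_kernel[of z 1 t 0 2] assms t by simp
  next
    show "set_integrable lborel {0<..} (\<lambda>t. complex_of_real (sqrt t) / (complex_of_real t + z)\<^sup>2)"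
      using set_integrable_sqrt_kernel[of z 1 0 2] assms by simp
    show "(F \<longlongrightarrow> 0 / c - of_real (sqrt 0) / (of_real 0 + z)) (at_right 0)"
      unfolding F_def using c assms by (intro tendsto_intros tendsto_Arctan_sqrt_at_right) auto
    have "((\<lambda>t. complex_of_real (sqrt t) / (complex_of_real t + z)) \<longlongrightarrow> 0) at_top"
      using tendsto_power_sqrt_div_at_top[of z 0 1] assms by simp
    then show "(F \<longlongrightarrow> of_real (pi / 2) / c - 0) at_top"
      unfolding F_def using c by (intro tendsto_intros tendsto_Arctan_sqrt_at_top) simp_all
  qed
  also have "\<dots> = complex_of_real pi / (2 * c)"
    using c by simp
  finally show ?thesis by (simp only: c_def)
qed

section \<open>Catalan numbers: recursion and convergence of their series\<close>

text \<open>Both sides pass through the middle coefficient \<open>(2 * n + 1) choose n\<close>: the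
  absorption identity is applied twice, with symmetry of row \<open>2 * n + 1\<close> in
  between.\<close>

lemma Suc_mult_central_binomial_Suc:
  "Suc n * ((2 * Suc n) choose Suc n) = 2 * (2 * n + 1) * ((2 * n) choose n)"
proof -
  have "(2 * n + 1) choose n = (2 * n + 1) choose Suc n"
    using binomial_symmetric[of n "2 * n + 1"] by simp
  then have "Suc n * ((2 * n + 1) choose n) = (2 * n + 1) * ((2 * n) choose n)"
    using Suc_times_binomial[of n "2 * n"] by simp
  moreover have "Suc n * ((2 * Suc n) choose Suc n) = 2 * (Suc n * ((2 * n + 1) choose n))"
    using Suc_times_binomial[of n "2 * n + 1"] by simp
  ultimately show ?thesis by (simp only: mult.assoc)
qed

lemma Suc_mult_catalan: "real (k + 1) * catalan k = real ((2 * k) choose k)"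
  by (simp add: catalan_def)

lemma catalan_Suc: "real (n + 2) * catalan (Suc n) = 2 * (2 * real n + 1) * catalan n"
proof -
  have "real (Suc n) * real ((2 * Suc n) choose Suc n) = 2 * (2 * real n + 1) * real ((2 * n) choose n)"
    using arg_cong[OF Suc_mult_central_binomial_Suc[of n], of real]
    by (simp only: of_nat_mult of_nat_add of_nat_numeral of_nat_1)
  then have "real (n + 1) * (real (n + 2) * catalan (Suc n)) = real (n + 1) * (2 * (2 * real n + 1) * catalan n)"
    using Suc_mult_catalan[of n] Suc_mult_catalan[of "Suc n"] by (simp add: mult_ac del: binomial_Suc_Suc)
  then show ?thesis
    by (simp only: mult_cancel_left) simp
qed

text \<open>The sum telescopes, because \<open>catalan n / 4 ^ n\<close> is twice the drop from
  \<open>((2 * n) choose n) / 4 ^ n\<close> to its successor. The closed form bounds all partial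
  sums by 2 and so gives convergence at the radius \<open>1 / 4\<close> itself, with no
  asymptotics.\<close>

lemma sum_catalan_div_power_4:
  "(\<Sum>k<n. catalan k / 4 ^ k) = 2 * (1 - real ((2 * n) choose n) / 4 ^ n)"
proof (induction n)
  case (Suc n)
  have "real ((2 * Suc n) choose Suc n) = 2 * (2 * real n + 1) * catalan n"
    using catalan_Suc[of n] Suc_mult_catalan[of "Suc n"] by simp
  moreover have "2 * (1 - real (n + 1) * C / p) + C / p = 2 * (1 - 2 * (2 * real n + 1) * C / (4 * p))"
    if "p \<noteq> 0" for C p
    using that by (simp add: field_simps)
  ultimately show ?case
    unfolding sum.lessThan_Suc Suc.IH Suc_mult_catalan[of n, symmetric] by simp
qed simp

lemma catalan_nonneg: "catalan k \<ge> 0"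
  by (simp add: catalan_def)

text \<open>The closed disc is required: the line \<open>Re z = 1 / 2\<close> is mapped into its
  boundary by \<open>(z - 1) / (4 * z)\<close>.\<close>

lemma summable_norm_catalan_power:
  fixes x :: complex
  assumes "norm x \<le> 1 / 4"
  shows "summable (\<lambda>k. norm (of_real (catalan k) * x ^ k))"
proof (rule summable_comparison_test')
  show "summable (\<lambda>k. catalan k / 4 ^ k)"
  proof (rule summableI_nonneg_bounded)
    show "(\<Sum>k<n. catalan k / 4 ^ k) \<le> 2" for n
      by (simp add: sum_catalan_div_power_4)
  qed (simp add: catalan_nonneg)
  show "norm (norm (of_real (catalan k) * x ^ k)) \<le> catalan k / 4 ^ k" for k
  proof -
    have "norm (norm (of_real (catalan k) * x ^ k)) = catalan k * norm x ^ k"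
      by (simp add: norm_mult norm_power catalan_nonneg)
    also have "\<dots> \<le> catalan k * (1 / 4) ^ k"
      using assms by (intro mult_left_mono power_mono catalan_nonneg) auto
    also have "\<dots> = catalan k / 4 ^ k"
      by (simp add: power_divide)
    finally show ?thesis .
  qed
qed

section \<open>Recursions for the integrals and the finite formula\<close>

text \<open>The function \<open>t * sqrt t / (t + z) ^ m\<close> vanishes at 0 and, as
  \<open>m \<ge> 2\<close>, at infinity, so its derivative integrates to 0. Replacing
  \<open>t\<close> by \<open>(t + z) - z\<close> in that derivative leaves only the exponents
  \<open>m\<close> and \<open>m + 1\<close>.\<close>

lemma LBINT_sqrt_div_power_Suc:
  assumes "Re z > 0" "m \<ge> 2"
  shows "of_nat m * z * (LBINT t=0..\<infinity>. complex_of_real (sqrt t) / (complex_of_real t + z) ^ Suc m)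
       = (of_nat m - 3 / 2) * (LBINT t=0..\<infinity>. complex_of_real (sqrt t) / (complex_of_real t + z) ^ m)"
proof -
  define f where "f = (\<lambda>n t. complex_of_real (sqrt t) / (complex_of_real t + z) ^ n)"
  define F where "F = (\<lambda>t. complex_of_real (t * sqrt t) * inverse ((complex_of_real t + z) ^ m))"
  have int: "set_integrable lborel {0<..} (f n)" if "n \<ge> 2" for n
    using set_integrable_sqrt_kernel[of z 1 0 n] assms that by (simp add: f_def)
  have cont: "isCont (f n) t" if "t > 0" for n t
    using isCont_sqrt_kernel[of z 1 t 0 n] assms that by (simp add: f_def)
  have "(LBINT t=0..\<infinity>. of_nat m * z * f (Suc m) t - (of_nat m - 3 / 2) * f m t) = 0 - 0"
  proof (rule interval_integral_FTC_0_infinity[where F = F])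
    fix t :: real assume t: "t > 0"
    define s where "s = complex_of_real (sqrt t)"
    define d where "d = complex_of_real t + z"
    have d: "d \<noteq> 0" using of_real_add_nonzero[of z t] assms t by (simp add: d_def)
    have "((\<lambda>t. t * sqrt t) has_field_derivative (t * (inverse (sqrt t) / 2) + 1 * sqrt t)) (at t)"
      by (intro DERIV_mult' DERIV_ident DERIV_real_sqrt t)
    moreover have "t * inverse (sqrt t) = sqrt t"
      using t by (metis divide_inverse less_imp_le real_div_sqrt)
    ultimately have "((\<lambda>t. t * sqrt t) has_field_derivative (3 / 2 * sqrt t)) (at t)"
      by simp
    then have 1: "((\<lambda>t. complex_of_real (t * sqrt t)) has_vector_derivative of_real (3 / 2 * sqrt t)) (at t)"
      by (rule has_vector_derivative_of_real)
    have "((\<lambda>w. inverse ((w + z) ^ m)) has_field_derivative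
        - (inverse (d ^ m) * (of_nat m * (1 * d ^ (m - 1))) * inverse (d ^ m))) (at (of_real t))"
      using d by (auto intro!: derivative_eq_intros simp: d_def)
    moreover have "inverse (d ^ m) * (of_nat m * (1 * d ^ (m - 1))) * inverse (d ^ m) = of_nat m / d ^ Suc m"
      using d assms by (cases m) (auto simp: field_simps)
    ultimately have "((\<lambda>w. inverse ((w + z) ^ m)) has_field_derivative - (of_nat m / d ^ Suc m)) (at (of_real t))"
      by simp
    then have 2: "((\<lambda>t. inverse ((of_real t + z) ^ m)) has_vector_derivative - (of_nat m / d ^ Suc m)) (at t)"
      by (rule has_vector_derivative_real_field)
    have "(F has_vector_derivative (complex_of_real (t * sqrt t) * - (of_nat m / d ^ Suc m) + of_real (3 / 2 * sqrt t) * inverse ((complex_of_real t + z) ^ m))) (at t)"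
      unfolding F_def by (intro has_vector_derivative_mult 1 2)
    moreover have "complex_of_real (t * sqrt t) * - (of_nat m / d ^ Suc m) + of_real (3 / 2 * sqrt t) * inverse ((complex_of_real t + z) ^ m)
        = of_nat m * z * f (Suc m) t - (of_nat m - 3 / 2) * f m t"
    proof -
      have "(d - z) * s * - (of_nat m / d ^ Suc m) + 3 / 2 * s * inverse (d ^ m)
          = of_nat m * z * (s / d ^ Suc m) - (of_nat m - 3 / 2) * (s / d ^ m)"
        using d by (simp add: field_simps)
      moreover have "complex_of_real (t * sqrt t) = (d - z) * s" "of_real (3 / 2 * sqrt t) = 3 / 2 * s"
        by (simp_all add: d_def s_def)
      ultimately show ?thesis
        by (simp only: f_def s_def[symmetric] d_def[symmetric])
    qed
    ultimately show "(F has_vector_derivative of_nat m * z * f (Suc m) t - (of_nat m - 3 / 2) * f m t) (at t)"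
      by simp
  next
    show "isCont (\<lambda>t. of_nat m * z * f (Suc m) t - (of_nat m - 3 / 2) * f m t) t" if "t > 0" for t
      using cont[OF that] by (intro continuous_intros)
    show "set_integrable lborel {0<..} (\<lambda>t. of_nat m * z * f (Suc m) t - (of_nat m - 3 / 2) * f m t)"
      using assms by (intro set_integral_diff set_integrable_mult_right int) auto
    have "(F \<longlongrightarrow> complex_of_real (0 * sqrt 0) * inverse ((complex_of_real 0 + z) ^ m)) (at_right 0)"
      unfolding F_def using assms by (intro tendsto_intros) auto
    then show "(F \<longlongrightarrow> 0) (at_right 0)" by simp
    show "(F \<longlongrightarrow> 0) at_top"
      using tendsto_power_sqrt_div_at_top[of z 1 m] assms by (simp add: F_def divide_inverse)
  qed
  moreover have "(LBINT t=0..\<infinity>. of_nat m * z * f (Suc m) t - (of_nat m - 3 / 2) * f m t)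
     = of_nat m * z * (LBINT t=0..\<infinity>. f (Suc m) t) - (of_nat m - 3 / 2) * (LBINT t=0..\<infinity>. f m t)"
    using assms by (subst interval_lebesgue_integral_diff)
      (auto intro!: interval_lebesgue_integrable_mult_right simp: interval_lebesgue_integrable_0_infinity int)
  ultimately show ?thesis by (simp add: f_def)
qed

text \<open>For \<open>m = n + 2\<close> the ratio \<open>(m - 3 / 2) / (m * z)\<close> of
  consecutive integrals is exactly the ratio of \<open>catalan (Suc n)\<close> to
  \<open>catalan n\<close>, divided by \<open>4 * z\<close>.\<close>

lemma LBINT_sqrt_div_power:
  assumes "Re z > 0"
  shows "(LBINT t=0..\<infinity>. complex_of_real (sqrt t) / (complex_of_real t + z) ^ (n + 2))
       = complex_of_real pi / (2 * csqrt z) * (of_real (catalan n) / (4 * z) ^ n)"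
proof (induction n)
  case 0
  show ?case using LBINT_sqrt_div_square[OF assms] by (simp add: catalan_def power2_eq_square)
next
  case (Suc n)
  have z: "z \<noteq> 0" using assms by auto
  define P where "P = complex_of_real pi / (2 * csqrt z)"
  define X where "X = (LBINT t=0..\<infinity>. complex_of_real (sqrt t) / (complex_of_real t + z) ^ (Suc n + 2))"
  have cat: "of_nat (n + 2) * complex_of_real (catalan (Suc n)) = 2 * (2 * of_nat n + 1) * of_real (catalan n)"
    using arg_cong[OF catalan_Suc[of n], of complex_of_real] by simp
  have "of_nat (n + 2) * z * X = (of_nat (n + 2) - 3 / 2) * (P * (of_real (catalan n) / (4 * z) ^ n))"
    using LBINT_sqrt_div_power_Suc[OF assms, of "n + 2"] unfolding Suc.IH X_def P_def by simp
  \<comment> \<open>Written this way to expose the factor \<open>2 * (2 * n + 1)\<close> of the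
    Catalan recursion; the 4 joins \<open>(4 * z) ^ n\<close>.\<close>
  also have "of_nat (n + 2) - 3 / 2 = (2 * (2 * of_nat n + 1) / 4 :: complex)"
    by simp
  also have "2 * (2 * of_nat n + 1) / 4 * (P * (of_real (catalan n) / (4 * z) ^ n))
      = P * (2 * (2 * of_nat n + 1) * of_real (catalan n)) / (4 * (4 * z) ^ n)"
    by (simp only: times_divide_times_eq times_divide_eq_left times_divide_eq_right divide_divide_eq_left mult_ac)
  also have "\<dots> = of_nat (n + 2) * z * (P * (of_real (catalan (Suc n)) / (4 * z) ^ Suc n))"
    unfolding cat[symmetric] using z by simp
  finally have "of_nat (n + 2) * z * X = of_nat (n + 2) * z * (P * (of_real (catalan (Suc n)) / (4 * z) ^ Suc n))" .
  moreover have "of_nat (n + 2) * z \<noteq> 0" using z by (simp del: of_nat_add of_nat_Suc)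
  ultimately show ?case unfolding X_def P_def by (simp only: mult_cancel_left) simp
qed

text \<open>Write \<open>z - 1 = (t + z) - (t + 1)\<close>: each difference term cancels one factor
  of the denominator.\<close>

lemma LBINT_sqrt_div_mult_power_Suc:
  assumes "Re z > 0"
  shows "(z - 1) * (LBINT t=0..\<infinity>. complex_of_real (sqrt t) / ((complex_of_real t + 1) * (complex_of_real t + z) ^ (n + 2)))
     = (LBINT t=0..\<infinity>. complex_of_real (sqrt t) / ((complex_of_real t + 1) * (complex_of_real t + z) ^ (n + 1)))
       - (LBINT t=0..\<infinity>. complex_of_real (sqrt t) / (complex_of_real t + z) ^ (n + 2))"
proof -
  have key: "(z - 1) * (s / (p * d ^ (n + 2))) = s / (p * d ^ (n + 1)) - s / d ^ (n + 2)"
    if "d \<noteq> 0" "p \<noteq> 0" "z - 1 = d - p" for s d p :: complex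
    using that(1,2) unfolding that(3) by (simp add: field_simps)
  have "(LBINT t=0..\<infinity>. (z - 1) * (complex_of_real (sqrt t) / ((complex_of_real t + 1) * (complex_of_real t + z) ^ (n + 2))))
     = (LBINT t=0..\<infinity>. complex_of_real (sqrt t) / ((complex_of_real t + 1) * (complex_of_real t + z) ^ (n + 1))
       - complex_of_real (sqrt t) / (complex_of_real t + z) ^ (n + 2))"
    using of_real_add_nonzero[of z] of_real_add_nonzero[of 1] assms
    by (intro interval_integral_cong key) (auto simp: zero_ereal_def)
  also have "\<dots> = (LBINT t=0..\<infinity>. complex_of_real (sqrt t) / ((complex_of_real t + 1) * (complex_of_real t + z) ^ (n + 1)))
       - (LBINT t=0..\<infinity>. complex_of_real (sqrt t) / (complex_of_real t + z) ^ (n + 2))"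
    using set_integrable_sqrt_kernel[of z 1 1 "n + 1"] set_integrable_sqrt_kernel[of z 1 0 "n + 2"] assms
    by (intro interval_lebesgue_integral_diff) (simp_all add: interval_lebesgue_integrable_0_infinity)
  finally show ?thesis unfolding interval_lebesgue_integral_mult_right .
qed

text \<open>Each induction step subtracts one integral without the factor \<open>t + 1\<close>,
  which contributes the next Catalan summand, and divides by \<open>z - 1\<close>. The induction
  starts at the empty sum, that is, at the first base integral.\<close>

lemma LBINT_sqrt_div_mult_power:
  assumes "Re z > 0" "z \<noteq> 1"
  shows "(LBINT t=0..\<infinity>. complex_of_real (sqrt t) / ((complex_of_real t + 1) * (complex_of_real t + z) ^ (n + 1)))
     = complex_of_real pi / (z - 1) ^ (n + 1) * (csqrt z - 1
        - (z - 1) / (2 * csqrt z) * (\<Sum>k<n. complex_of_real (catalan k) * ((z - 1) / (4 * z)) ^ k))"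
proof (induction n)
  case 0
  then show ?case using LBINT_sqrt_div_mult[OF assms] by simp
next
  case (Suc n)
  define X where "X = (LBINT t=0..\<infinity>. complex_of_real (sqrt t) / ((complex_of_real t + 1) * (complex_of_real t + z) ^ (n + 2)))"
  define S where "S = (\<Sum>k<n. complex_of_real (catalan k) * ((z - 1) / (4 * z)) ^ k)"
  define y c C where "y = z - 1" and "c = csqrt z" and "C = complex_of_real (catalan n)"
  have nz: "y \<noteq> 0" "c \<noteq> 0" "z \<noteq> 0" using assms by (auto simp: y_def c_def)
  have "y * X = of_real pi / y ^ (n + 1) * (c - 1 - y / (2 * c) * S) - of_real pi / (2 * c) * (C / (4 * z) ^ n)"
    using LBINT_sqrt_div_mult_power_Suc[OF assms(1), of n]
    unfolding Suc.IH LBINT_sqrt_div_power[OF assms(1)] X_def S_def y_def c_def C_def by simp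
  \<comment> \<open>Extracting the common prefactor supplies \<open>n + 1\<close> powers of
    \<open>y\<close>: \<open>n\<close> of them form \<open>(y / (4 * z)) ^ n\<close> and the last
    one goes to \<open>y / (2 * c)\<close>.\<close>
  also have "of_real pi / (2 * c) * (C / (4 * z) ^ n) = of_real pi / y ^ (n + 1) * (y / (2 * c) * (C * (y / (4 * z)) ^ n))"
    using nz by (simp add: power_divide)
  also have "of_real pi / y ^ (n + 1) * (c - 1 - y / (2 * c) * S) - of_real pi / y ^ (n + 1) * (y / (2 * c) * (C * (y / (4 * z)) ^ n))
      = y * (of_real pi / y ^ (n + 2) * (c - 1 - y / (2 * c) * (S + C * (y / (4 * z)) ^ n)))"
    using nz by (simp add: algebra_simps)
  finally have "X = of_real pi / y ^ (n + 2) * (c - 1 - y / (2 * c) * (S + C * (y / (4 * z)) ^ n))"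
    using nz(1) by (simp only: mult_cancel_left) simp
  then show ?case by (simp add: X_def S_def y_def c_def C_def)
qed

section \<open>The vanishing remainder and the Catalan generating function for
  \<open>Re z \<ge> 1 / 2\<close>\<close>

text \<open>The half-plane consists of the points at least as close to 1 as to 0.\<close>

lemma norm_diff_one_le_norm:
  fixes z :: complex
  assumes "Re z \<ge> 1 / 2"
  shows "norm (z - 1) \<le> norm z"
proof -
  have "(norm (z - 1))\<^sup>2 = (norm z)\<^sup>2 - (2 * Re z - 1)"
    by (simp add: cmod_power2) (simp add: power2_eq_square algebra_simps)
  with assms have "(norm (z - 1))\<^sup>2 \<le> (norm z)\<^sup>2" by simp
  then show ?thesis by (rule power2_le_imp_le) simp
qed

lemma norm_less_norm_of_real_add:
  fixes z :: complex
  assumes "Re z > 0" "t > 0"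
  shows "norm z < norm (of_real t + z)"
proof -
  have "(norm (of_real t + z))\<^sup>2 = (norm z)\<^sup>2 + (t * t + 2 * (t * Re z))"
    by (simp add: cmod_power2) (simp add: power2_eq_square algebra_simps)
  moreover have "t * t + 2 * (t * Re z) > 0"
    using assms by (intro add_pos_pos mult_pos_pos) auto
  ultimately have "(norm z)\<^sup>2 < (norm (of_real t + z))\<^sup>2" by simp
  then show ?thesis by (rule power2_less_imp_less) simp
qed

text \<open>The factor \<open>((z - 1) / (t + z)) ^ n\<close> tends to 0 for each
  \<open>t > 0\<close>. If \<open>Re z = 1 / 2\<close>, the modulus of its base tends to 1 as
  \<open>t\<close> tends to 0, so a uniform geometric bound fails; dominated convergence with the
  integrand for \<open>n = 0\<close> covers this case too.\<close>

lemma tendsto_power_mult_LBINT_sqrt: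
  assumes "Re z \<ge> 1 / 2"
  shows "(\<lambda>n. (z - 1) ^ n * (LBINT t=0..\<infinity>. complex_of_real (sqrt t) / ((complex_of_real t + 1) * (complex_of_real t + z) ^ (n + 1)))) \<longlonglongrightarrow> 0"
proof -
  define f where "f = (\<lambda>n t. complex_of_real (sqrt t) / ((complex_of_real t + 1) * (complex_of_real t + z) ^ (n + 1)))"
  have z: "Re z > 0" using assms by simp
  have int: "set_integrable lborel {0<..} (f n)" for n
    using set_integrable_sqrt_kernel[of z 1 1 "n + 1"] z by (simp add: f_def)
  have eq: "(z - 1) ^ n * f n t = f 0 t * ((z - 1) / (of_real t + z)) ^ n" for n t
    by (simp add: f_def power_divide mult_ac)
  have less: "norm ((z - 1) / (of_real t + z)) < 1" if "t > 0" for t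
    using norm_diff_one_le_norm[OF assms] norm_less_norm_of_real_add[OF z that] of_real_add_nonzero[OF z, of t] that
    by (simp add: norm_divide)
  have "(\<lambda>n. \<integral>t. indicator {0<..} t *\<^sub>R ((z - 1) ^ n * f n t) \<partial>lborel) \<longlonglongrightarrow> (\<integral>t. 0 \<partial>(lborel :: real measure))"
  proof (rule integral_dominated_convergence[where w = "\<lambda>t. norm (indicator {0<..} t *\<^sub>R f 0 t)"])
    show "integrable lborel (\<lambda>t. norm (indicator {0<..} t *\<^sub>R f 0 t))"
      using int[of 0] unfolding set_integrable_def by (intro integrable_norm) simp
    show "(\<lambda>t. indicator {0<..} t *\<^sub>R ((z - 1) ^ n * f n t)) \<in> borel_measurable lborel" for n
      unfolding f_def by measurable
    show "AE t in lborel. (\<lambda>n. indicator {0<..} t *\<^sub>R ((z - 1) ^ n * f n t)) \<longlonglongrightarrow> 0"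
    proof (intro AE_I2)
      fix t :: real
      show "(\<lambda>n. indicator {0<..} t *\<^sub>R ((z - 1) ^ n * f n t)) \<longlonglongrightarrow> 0"
      proof (cases "t > 0")
        case True
        have "(\<lambda>n. f 0 t * ((z - 1) / (of_real t + z)) ^ n) \<longlonglongrightarrow> f 0 t * 0"
          by (intro tendsto_intros LIMSEQ_power_zero less True)
        with True show ?thesis by (simp add: eq)
      qed simp
    qed
    show "AE t in lborel. norm (indicator {0<..} t *\<^sub>R ((z - 1) ^ n * f n t)) \<le> norm (indicator {0<..} t *\<^sub>R f 0 t)" for n
    proof (intro AE_I2)
      fix t :: real
      have "norm (f 0 t) * norm ((z - 1) / (of_real t + z)) ^ n \<le> norm (f 0 t) * 1" if "t > 0"
        using less[OF that] by (intro mult_left_mono power_le_one) auto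
      then show "norm (indicator {0<..} t *\<^sub>R ((z - 1) ^ n * f n t)) \<le> norm (indicator {0<..} t *\<^sub>R f 0 t)"
        unfolding eq by (auto simp: indicator_def norm_mult norm_power)
    qed
  qed simp
  also have "(\<lambda>n. \<integral>t. indicator {0<..} t *\<^sub>R ((z - 1) ^ n * f n t) \<partial>lborel) = (\<lambda>n. (z - 1) ^ n * (LBINT t=0..\<infinity>. f n t))"
  proof
    fix n
    have "(\<integral>t. indicator {0<..} t *\<^sub>R ((z - 1) ^ n * f n t) \<partial>lborel) = (LBINT t=0..\<infinity>. (z - 1) ^ n * f n t)"
      unfolding interval_lebesgue_integral_def set_lebesgue_integral_def by (simp add: zero_ereal_def)
    then show "(\<integral>t. indicator {0<..} t *\<^sub>R ((z - 1) ^ n * f n t) \<partial>lborel) = (z - 1) ^ n * (LBINT t=0..\<infinity>. f n t)"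
      by simp
  qed
  finally show ?thesis by (simp add: f_def)
qed

text \<open>For \<open>x = (z - 1) / (4 * z)\<close> one has \<open>1 - 4 * x = 1 / z\<close>, so
  the value is the familiar \<open>(1 - sqrt (1 - 4 * x)) / (2 * x)\<close>. Solving the finite
  formula for the partial sum leaves the scaled integral as error term, and that tends to 0.\<close>

lemma sums_catalan_power:
  assumes "Re z \<ge> 1 / 2" "z \<noteq> 1"
  shows "(\<lambda>k. complex_of_real (catalan k) * ((z - 1) / (4 * z)) ^ k) sums (2 * csqrt z / (z - 1) * (csqrt z - 1))"
proof -
  define I where "I = (\<lambda>n. LBINT t=0..\<infinity>. complex_of_real (sqrt t) / ((complex_of_real t + 1) * (complex_of_real t + z) ^ (n + 1)))"
  define S where "S = (\<lambda>n. \<Sum>k<n. complex_of_real (catalan k) * ((z - 1) / (4 * z)) ^ k)"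
  define y c where "y = z - 1" and "c = csqrt z"
  have z: "Re z > 0" using assms by simp
  have nz: "y \<noteq> 0" "c \<noteq> 0" using assms by (auto simp: y_def c_def)
  have "S n = 2 * c / y * (c - 1 - y / of_real pi * (y ^ n * I n))" for n
  proof -
    have "I n = of_real pi / y ^ (n + 1) * (c - 1 - y / (2 * c) * S n)"
      unfolding I_def S_def y_def c_def by (rule LBINT_sqrt_div_mult_power[OF z assms(2)])
    then have "y / of_real pi * (y ^ n * I n) = c - 1 - y / (2 * c) * S n"
      using nz by simp
    then show ?thesis using nz by simp
  qed
  moreover have "(\<lambda>n. 2 * c / y * (c - 1 - y / of_real pi * (y ^ n * I n))) \<longlonglongrightarrow> 2 * c / y * (c - 1 - y / of_real pi * 0)"
    unfolding I_def y_def by (intro tendsto_intros tendsto_power_mult_LBINT_sqrt assms)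
  ultimately show ?thesis by (simp add: sums_def S_def y_def c_def)
qed

section \<open>The integral formulas and the tail of the Catalan series\<close>

theorem theorem2p4:
  fixes z :: complex
  assumes "Re z > 0" and "z \<noteq> 1"
  shows
    "(interval_lebesgue_integrable lborel 0 \<infinity>
       (\<lambda>t. complex_of_real (sqrt t) / ((complex_of_real t + 1) * (complex_of_real t + z)))
     \<and> (LBINT t=0..\<infinity>. complex_of_real (sqrt t) / ((complex_of_real t + 1) * (complex_of_real t + z)))
       = complex_of_real pi / (z - 1) * (csqrt z - 1))
     \<and> (\<forall>j::nat. j \<ge> 1 \<longrightarrow>
       interval_lebesgue_integrable lborel 0 \<infinity>
         (\<lambda>t. complex_of_real (sqrt t) / ((complex_of_real t + 1) * (complex_of_real t + z) ^ (j + 1)))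
       \<and> (LBINT t=0..\<infinity>. complex_of_real (sqrt t) / ((complex_of_real t + 1) * (complex_of_real t + z) ^ (j + 1)))
         = complex_of_real pi / (z - 1) ^ (j + 1)
           * (csqrt z - 1
              - (z - 1) / (2 * csqrt z)
                * (\<Sum>k=0..j-1. complex_of_real (catalan k) * ((z - 1) / (4 * z)) ^ k)))
     \<and> (Re z \<ge> 1 / 2 \<longrightarrow>
       (\<forall>j::nat. j \<ge> 1 \<longrightarrow>
         (\<lambda>k. complex_of_real (catalan k) * ((z - 1) / (4 * z)) ^ k) summable_on {j..}
         \<and> (LBINT t=0..\<infinity>. complex_of_real (sqrt t) / ((complex_of_real t + 1) * (complex_of_real t + z) ^ (j + 1)))
           = complex_of_real pi / (2 * csqrt z * (z - 1) ^ j)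
             * (\<Sum>\<^sub>\<infinity>k\<in>{j..}. complex_of_real (catalan k) * ((z - 1) / (4 * z)) ^ k)))"
proof (intro conjI allI impI)
  show "interval_lebesgue_integrable lborel 0 \<infinity>
       (\<lambda>t. complex_of_real (sqrt t) / ((complex_of_real t + 1) * (complex_of_real t + z)))"
    using set_integrable_sqrt_kernel[of z 1 1 1] assms
    by (simp add: interval_lebesgue_integrable_0_infinity)
  show "(LBINT t=0..\<infinity>. complex_of_real (sqrt t) / ((complex_of_real t + 1) * (complex_of_real t + z)))
       = complex_of_real pi / (z - 1) * (csqrt z - 1)"
    by (rule LBINT_sqrt_div_mult[OF assms])
next
  fix j :: nat
  assume j: "j \<ge> 1"
  show "interval_lebesgue_integrable lborel 0 \<infinity>
         (\<lambda>t. complex_of_real (sqrt t) / ((complex_of_real t + 1) * (complex_of_real t + z) ^ (j + 1)))"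
    using set_integrable_sqrt_kernel[of z 1 1 "j + 1"] assms
    by (simp add: interval_lebesgue_integrable_0_infinity)
  \<comment> \<open>Subtraction on naturals is truncated, so \<open>j \<ge> 1\<close> matters: for
    \<open>j = 0\<close> the left side would be \<open>{0}\<close>.\<close>
  have "{0..j - 1} = {..<j}" using j by auto
  then show "(LBINT t=0..\<infinity>. complex_of_real (sqrt t) / ((complex_of_real t + 1) * (complex_of_real t + z) ^ (j + 1)))
         = complex_of_real pi / (z - 1) ^ (j + 1)
           * (csqrt z - 1
              - (z - 1) / (2 * csqrt z)
                * (\<Sum>k=0..j-1. complex_of_real (catalan k) * ((z - 1) / (4 * z)) ^ k))"
    by (simp only: LBINT_sqrt_div_mult_power[OF assms])
next
  fix j :: nat
  assume half: "Re z \<ge> 1 / 2"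
  define a where "a = (\<lambda>k. complex_of_real (catalan k) * ((z - 1) / (4 * z)) ^ k)"
  define y c where "y = z - 1" and "c = csqrt z"
  have nz: "y \<noteq> 0" "c \<noteq> 0" using assms by (auto simp: y_def c_def)
  have "norm ((z - 1) / (4 * z)) \<le> 1 / 4"
    using norm_diff_one_le_norm[OF half] by (simp add: norm_divide norm_mult divide_le_eq)
  then have "summable (\<lambda>k. norm (a k))"
    unfolding a_def by (rule summable_norm_catalan_power)
  moreover have "a sums (2 * c / y * (c - 1))"
    unfolding a_def y_def c_def by (rule sums_catalan_power[OF half assms(2)])
  \<comment> \<open>Absolute convergence turns the ordered sum into an unordered one; the finite
    initial segment is then removed to reach the tail.\<close>
  ultimately have "(a has_sum (2 * c / y * (c - 1))) UNIV"
    by (rule norm_summable_imp_has_sum)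
  moreover have "(a has_sum (\<Sum>k<j. a k)) {..<j}"
    by (rule has_sum_finite) simp
  ultimately have "(a has_sum (2 * c / y * (c - 1) - (\<Sum>k<j. a k))) (UNIV - {..<j})"
    by (rule has_sum_Diff) simp
  moreover have "UNIV - {..<j} = {j..}" by auto
  ultimately have sum: "(a has_sum (2 * c / y * (c - 1) - (\<Sum>k<j. a k))) {j..}" by simp
  then show "a summable_on {j..}" by (rule has_sum_imp_summable)
  \<comment> \<open>Taking \<open>y / (2 * c)\<close> out of the bracket turns \<open>c - 1\<close>
    into the full series value, so what remains is the tail.\<close>
  have "of_real pi / y ^ (j + 1) * (c - 1 - y / (2 * c) * (\<Sum>k<j. a k))
      = of_real pi / (2 * c * y ^ j) * (2 * c / y * (c - 1) - (\<Sum>k<j. a k))"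
    using nz by (simp add: field_simps)
  then show "(LBINT t=0..\<infinity>. complex_of_real (sqrt t) / ((complex_of_real t + 1) * (complex_of_real t + z) ^ (j + 1)))
           = complex_of_real pi / (2 * csqrt z * (z - 1) ^ j) * infsum a {j..}"
    unfolding infsumI[OF sum] unfolding LBINT_sqrt_div_mult_power[OF assms] a_def y_def c_def .
qed

end
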